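(* Fix $n,d,e\in\mathbb{N}$ with $n\ge 2$, put $m=d+1$, and assume that the Padé matrix $P_T$ is square and non-singular (i.e. $f:=\det P_T$ is a nonzero polynomial). Let $w$ be the vector of those variables $c_\gamma$ that appear in $P_T$, and let $|w|$ be its length. Suppose that $\mathcal{T}^n_{d,e,d+1}=V(f)$, and set $f_\gamma=\frac{\partial f}{\partial c_\gamma}$. Then the image of the polar map $$w\mapsto (f_\gamma : c_\gamma\in w)$$ (a rational map from $\mathbb{P}^{|w|-1}$ to $\mathbb{P}^{|w|-1}$) is not dense in $\mathbb{P}^{|w|-1}$; consequently the hypersurface $\mathcal{T}^n_{d,e,d+1}$ has vanishing Hessian, i.e. the determinant of the Hessian matrix $\left(\frac{\partial^2 f}{\partial c_\gamma\partial c_\delta}\right)_{c_\gamma,c_\delta\in w}$ is the zero polynomial.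
   Context: Work over $\mathbb{C}$ with variables $x=(x_1,\dots,x_n)$; for $\gamma\in\mathbb{N}^n$ write $x^\gamma=x_1^{\gamma_1}\cdots x_n^{\gamma_n}$ and $|\gamma|=\gamma_1+\cdots+\gamma_n$. Let $\mathbb{P}^{\binom{n+m}{n}-1}$ be the projective space with coordinates $c_\gamma$, $|\gamma|\le m$, whose points are nonzero polynomials $T=\sum_{|\gamma|\le m}c_\gamma x^\gamma$ up to scaling. The Taylor variety $\mathcal{T}^n_{d,e,m}\subseteq\mathbb{P}^{\binom{n+m}{n}-1}$ is the Zariski closure of the set of all order-$m$ Taylor polynomials at the origin (Taylor series truncated after total degree $m$) of rational functions $P/Q$ with $P,Q\in\mathbb{C}[x]$, $\deg P\le d$, $\deg Q\le e$, $P(0)=Q(0)=1$. $M_{a,b}$ denotes the set of monomials in $x$ (identified with exponent vectors) of total degree at least $a$ and at most $b$. The Padé matrix $P_T$ is the $\left(\binom{m+n}{n}-\binom{d+n}{n}\right)\times\binom{e+n}{n}$ matrix with rows indexed by $M_{d+1,m}$ and columns indexed by $M_{0,e}$ (in fixed orderings), whose entry in row $x^\alpha$ and column $x^\beta$ is the indeterminate $c_{\alpha-\beta}$ if $\beta\le\alpha$ componentwise and $0$ otherwise. $V(f)$ denotes the zero locus of $f$ in $\mathbb{P}^{\binom{n+m}{n}-1}$. *)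

theory Defs
  imports
    "HOL-Library.Poly_Mapping"
    "HOL-Analysis.Derivative"
    "HOL.Hull"
    "Jordan_Normal_Form.Determinant"
begin

section \<open>Polynomials in several variables\<close>

text \<open>An exponent vector with variables indexed by \<open>'v\<close> is a finitely supported function
  \<open>'v \<Rightarrow>\<^sub>0 nat\<close>, and the polynomial ring over \<open>\<complex>\<close> in these variables is its monoid algebra.
  The variables \<open>x\<^sub>1, \<dots>, x\<^sub>n\<close> are indexed by \<open>{..<n}\<close>; the coordinates \<open>c\<^sub>\<gamma>\<close> are variables indexed by
  exponent vectors \<open>\<gamma>\<close> in the \<open>x\<close>-variables.\<close>

type_synonym exponent = "nat \<Rightarrow>\<^sub>0 nat"
type_synonym 'v cpoly = "('v \<Rightarrow>\<^sub>0 nat) \<Rightarrow>\<^sub>0 complex"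

definition total_deg :: "('v \<Rightarrow>\<^sub>0 nat) \<Rightarrow> nat" where
  "total_deg \<gamma> = (\<Sum>i\<in>Poly_Mapping.keys \<gamma>. Poly_Mapping.lookup \<gamma> i)"

definition pvar :: "'v \<Rightarrow> 'v cpoly" where
  "pvar i = Poly_Mapping.single (Poly_Mapping.single i 1) 1"

definition pvars :: "'v cpoly \<Rightarrow> 'v set" where
  "pvars p = (\<Union>\<mu>\<in>Poly_Mapping.keys p. Poly_Mapping.keys \<mu>)"

definition peval :: "'v cpoly \<Rightarrow> ('v \<Rightarrow> complex) \<Rightarrow> complex" where
  "peval p v = (\<Sum>\<mu>\<in>Poly_Mapping.keys p.
     Poly_Mapping.lookup p \<mu> * (\<Prod>i\<in>Poly_Mapping.keys \<mu>. v i ^ Poly_Mapping.lookup \<mu> i))"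

definition homogeneous :: "'v cpoly \<Rightarrow> bool" where
  "homogeneous p \<longleftrightarrow> (\<exists>k. \<forall>\<mu>\<in>Poly_Mapping.keys p. total_deg \<mu> = k)"

definition ppartial :: "'v \<Rightarrow> 'v cpoly \<Rightarrow> 'v cpoly" where
  "ppartial i p = (\<Sum>\<mu>\<in>Poly_Mapping.keys p.
     Poly_Mapping.single (\<mu> - Poly_Mapping.single i 1)
       (of_nat (Poly_Mapping.lookup \<mu> i) * Poly_Mapping.lookup p \<mu>))"

text \<open>The set \<open>M\<^sub>a\<^sub>,\<^sub>b\<close> of monomials in \<open>x\<^sub>1, \<dots>, x\<^sub>n\<close>. In particular the polynomials \<open>P \<in> \<complex>[x\<^sub>1, \<dots>, x\<^sub>n]\<close>
  with \<open>deg P \<le> d\<close> are those with \<open>Poly_Mapping.keys P \<subseteq> monomials n 0 d\<close>.\<close>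

definition monomials :: "nat \<Rightarrow> nat \<Rightarrow> nat \<Rightarrow> exponent set" where
  "monomials n a b = {\<gamma>. Poly_Mapping.keys \<gamma> \<subseteq> {..<n} \<and> a \<le> total_deg \<gamma> \<and> total_deg \<gamma> \<le> b}"


section \<open>Projective space with coordinates indexed by a finite set\<close>

text \<open>A coordinate vector on \<open>I\<close> is extended by zero outside \<open>I\<close>, so that it is determined by its
  coordinates in \<open>I\<close>. A point of the projective space is an equivalence class of nonzero vectors
  up to scaling; its dimension is \<open>card I - 1\<close>.\<close>

definition nonzero_vectors :: "'v set \<Rightarrow> ('v \<Rightarrow> complex) set" where
  "nonzero_vectors I = {v. (\<forall>i. i \<notin> I \<longrightarrow> v i = 0) \<and> (\<exists>i\<in>I. v i \<noteq> 0)}"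

definition scaling_rel :: "'v set \<Rightarrow> (('v \<Rightarrow> complex) \<times> ('v \<Rightarrow> complex)) set" where
  "scaling_rel I = {(u, v). u \<in> nonzero_vectors I \<and> v \<in> nonzero_vectors I \<and>
     (\<exists>c. c \<noteq> 0 \<and> v = (\<lambda>i. c * u i))}"

definition proj_space :: "'v set \<Rightarrow> ('v \<Rightarrow> complex) set set" where
  "proj_space I = nonzero_vectors I // scaling_rel I"

definition proj_point :: "'v set \<Rightarrow> ('v \<Rightarrow> complex) \<Rightarrow> ('v \<Rightarrow> complex) set" where
  "proj_point I v = scaling_rel I `` {v}"

lemma scaling_relI:
  "u \<in> nonzero_vectors I \<Longrightarrow> v \<in> nonzero_vectors I \<Longrightarrow> c \<noteq> 0 \<Longrightarrow> (\<And>i. v i = c * u i) \<Longrightarrow>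
    (u, v) \<in> scaling_rel I"
  unfolding scaling_rel_def by (simp add: fun_eq_iff) metis

lemma scaling_relE:
  assumes "(u, v) \<in> scaling_rel I"
  obtains c where "u \<in> nonzero_vectors I" "v \<in> nonzero_vectors I" "c \<noteq> 0" "\<forall>i. v i = c * u i"
proof -
  have uv: "u \<in> nonzero_vectors I" "v \<in> nonzero_vectors I"
    and ex: "\<exists>c. c \<noteq> 0 \<and> v = (\<lambda>i. c * u i)"
    using assms by (simp_all add: scaling_rel_def)
  obtain c where c: "c \<noteq> 0" "v = (\<lambda>i. c * u i)"
    using ex by (elim exE conjE)
  show thesis
    by (rule that[OF uv c(1)]) (simp add: c(2))
qed

lemma equiv_scaling_rel: "equiv (nonzero_vectors I) (scaling_rel I)"
proof (rule equivI)
  show "scaling_rel I \<subseteq> nonzero_vectors I \<times> nonzero_vectors I"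
    by (auto elim: scaling_relE)
  show "refl_on (nonzero_vectors I) (scaling_rel I)"
  proof (rule refl_onI)
    show "(u, u) \<in> scaling_rel I" if "u \<in> nonzero_vectors I" for u
      by (rule scaling_relI[of _ _ _ 1]) (simp_all add: that)
  qed
  show "sym (scaling_rel I)"
  proof (rule symI)
    fix u v assume "(u, v) \<in> scaling_rel I"
    then obtain c where c: "u \<in> nonzero_vectors I" "v \<in> nonzero_vectors I" "c \<noteq> 0"
      "\<forall>i. v i = c * u i"
      by (rule scaling_relE)
    show "(v, u) \<in> scaling_rel I"
      by (rule scaling_relI[of _ _ _ "inverse c"]) (simp_all add: c(1-3) c(4))
  qed
  show "trans (scaling_rel I)"
  proof (rule transI)
    fix u v w assume uv: "(u, v) \<in> scaling_rel I" and vw: "(v, w) \<in> scaling_rel I"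
    obtain b where b: "u \<in> nonzero_vectors I" "b \<noteq> 0" "\<forall>i. v i = b * u i"
      using uv by (rule scaling_relE)
    obtain c where c: "w \<in> nonzero_vectors I" "c \<noteq> 0" "\<forall>i. w i = c * v i"
      using vw by (rule scaling_relE)
    show "(u, w) \<in> scaling_rel I"
      by (rule scaling_relI[of _ _ _ "c * b"]) (simp_all add: b(1,2) c(1,2) b(3) c(3))
  qed
qed

definition zero_locus :: "'v set \<Rightarrow> 'v cpoly set \<Rightarrow> ('v \<Rightarrow> complex) set set" where
  "zero_locus I F = {p \<in> proj_space I. \<forall>f\<in>F. \<forall>v\<in>p. peval f v = 0}"

definition zariski_closed :: "'v set \<Rightarrow> ('v \<Rightarrow> complex) set set \<Rightarrow> bool" where
  "zariski_closed I Z \<longleftrightarrow>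
     (\<exists>F. (\<forall>f\<in>F. pvars f \<subseteq> I \<and> homogeneous f) \<and> Z = zero_locus I F)"

definition zariski_closure :: "'v set \<Rightarrow> ('v \<Rightarrow> complex) set set \<Rightarrow> ('v \<Rightarrow> complex) set set" where
  "zariski_closure I S = zariski_closed I hull S"

definition zariski_dense :: "'v set \<Rightarrow> ('v \<Rightarrow> complex) set set \<Rightarrow> bool" where
  "zariski_dense I S \<longleftrightarrow> zariski_closure I S = proj_space I"


section \<open>Taylor varieties\<close>

definition partial_deriv :: "nat \<Rightarrow> ((nat \<Rightarrow> complex) \<Rightarrow> complex) \<Rightarrow> (nat \<Rightarrow> complex) \<Rightarrow> complex" where
  "partial_deriv i g = (\<lambda>x. deriv (\<lambda>t. g (x(i := t))) (x i))"

definition iterated_partial ::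
    "nat \<Rightarrow> exponent \<Rightarrow> ((nat \<Rightarrow> complex) \<Rightarrow> complex) \<Rightarrow> (nat \<Rightarrow> complex) \<Rightarrow> complex" where
  "iterated_partial n \<gamma> g = fold (\<lambda>i. partial_deriv i ^^ Poly_Mapping.lookup \<gamma> i) [0..<n] g"

text \<open>The coefficient vector of the Taylor polynomial of order \<open>m\<close> of \<open>g\<close> at the origin.\<close>

definition taylor_poly ::
    "nat \<Rightarrow> nat \<Rightarrow> ((nat \<Rightarrow> complex) \<Rightarrow> complex) \<Rightarrow> exponent \<Rightarrow> complex" where
  "taylor_poly n m g = (\<lambda>\<gamma>. if \<gamma> \<in> monomials n 0 m
     then iterated_partial n \<gamma> g (\<lambda>_. 0) / (\<Prod>i<n. fact (Poly_Mapping.lookup \<gamma> i)) else 0)"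

definition taylor_variety :: "nat \<Rightarrow> nat \<Rightarrow> nat \<Rightarrow> nat \<Rightarrow> (exponent \<Rightarrow> complex) set set" where
  "taylor_variety n d e m = zariski_closure (monomials n 0 m)
     {proj_point (monomials n 0 m) (taylor_poly n m (\<lambda>x. peval P x / peval Q x)) | P Q.
        Poly_Mapping.keys P \<subseteq> monomials n 0 d \<and> Poly_Mapping.keys Q \<subseteq> monomials n 0 e \<and>
        peval P (\<lambda>_. 0) = 1 \<and> peval Q (\<lambda>_. 0) = 1}"


section \<open>Pade matrix, polar map and Hessian\<close>

text \<open>The lists \<open>rs\<close> and \<open>cs\<close> carry the orderings of the row and column indices.\<close>

definition pade_matrix :: "exponent list \<Rightarrow> exponent list \<Rightarrow> exponent cpoly mat" where
  "pade_matrix rs cs = mat (length rs) (length cs)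
     (\<lambda>(i, j). if \<forall>k. Poly_Mapping.lookup (cs ! j) k \<le> Poly_Mapping.lookup (rs ! i) k
      then pvar (rs ! i - cs ! j) else 0)"

definition matrix_vars :: "'v cpoly mat \<Rightarrow> 'v set" where
  "matrix_vars A = (\<Union>a\<in>elements_mat A. pvars a)"

text \<open>The image of a rational map is the image of the locus where it is defined by the given
  coordinates, i.e. where these do not vanish simultaneously.\<close>

definition polar_vector :: "'v set \<Rightarrow> 'v cpoly \<Rightarrow> ('v \<Rightarrow> complex) \<Rightarrow> 'v \<Rightarrow> complex" where
  "polar_vector W f v = (\<lambda>\<gamma>. if \<gamma> \<in> W then peval (ppartial \<gamma> f) v else 0)"

definition polar_image :: "'v set \<Rightarrow> 'v cpoly \<Rightarrow> ('v \<Rightarrow> complex) set set" where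
  "polar_image W f = {proj_point W (polar_vector W f v) | v.
     v \<in> nonzero_vectors W \<and> polar_vector W f v \<in> nonzero_vectors W}"

definition hessian_matrix :: "'v list \<Rightarrow> 'v cpoly \<Rightarrow> 'v cpoly mat" where
  "hessian_matrix ws f = mat (length ws) (length ws)
     (\<lambda>(i, j). ppartial (ws ! i) (ppartial (ws ! j) f))"

end

theory Submission
  imports Defs
begin

text \<open>Let \<open>k = m - e\<close> be the lowest degree of a variable in the Pade matrix. Multiplying a column by
  a monomial \<open>x\<^sup>\<delta>\<close> with \<open>1 \<le> |\<delta>| \<le> e\<close> gives another column, so column operations show that
  \<open>\<Sum> {c\<^sub>\<gamma> f\<^bsub>\<gamma>+\<delta>\<^esub> | |\<gamma>| = k} = 0\<close>. Hence the Hankel-type matrix \<open>(f\<^bsub>\<gamma>+\<delta>\<^esub>)\<close> has the kernel vector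
  \<open>(c\<^sub>\<gamma>)\<close>. Since the Pade matrix is square, there are at least as many \<open>\<delta>\<close> as \<open>\<gamma>\<close>, so one can select
  as many \<open>\<delta>\<close> as there are \<open>\<gamma>\<close>; the determinant \<open>det (y\<^bsub>\<gamma>+\<delta>\<^esub>)\<close>, a nonzero homogeneous polynomial,
  then vanishes on the image of the polar map. A vector in the kernel of the Hessian is obtained by
  convolving \<open>(c\<^sub>\<gamma>)\<close> with a left kernel vector of the matrix \<open>(f\<^bsub>\<gamma>+\<delta>\<^esub>)\<close>.\<close>

section \<open>Polynomial rings\<close>

lemma poly_mapping_expansion:
  "p = (\<Sum>\<mu>\<in>Poly_Mapping.keys p. Poly_Mapping.single \<mu> (Poly_Mapping.lookup p \<mu>))"
proof (rule poly_mapping_eqI)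
  fix \<nu>
  have "Poly_Mapping.lookup (\<Sum>\<mu>\<in>Poly_Mapping.keys p.
      Poly_Mapping.single \<mu> (Poly_Mapping.lookup p \<mu>)) \<nu> =
    (\<Sum>\<mu>\<in>Poly_Mapping.keys p. if \<mu> = \<nu> then Poly_Mapping.lookup p \<mu> else 0)"
    by (simp add: lookup_sum lookup_single when_def)
  also have "\<dots> = Poly_Mapping.lookup p \<nu>"
    by (simp add: in_keys_iff)
  finally show "Poly_Mapping.lookup p \<nu> = Poly_Mapping.lookup (\<Sum>\<mu>\<in>Poly_Mapping.keys p.
      Poly_Mapping.single \<mu> (Poly_Mapping.lookup p \<mu>)) \<nu>" by simp
qed

lemma poly_mapping_additive_induct [case_names single add]:
  fixes p :: "'k \<Rightarrow>\<^sub>0 'a :: comm_monoid_add"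
  assumes single: "\<And>\<mu> a. P (Poly_Mapping.single \<mu> a)"
    and add: "\<And>p q. P p \<Longrightarrow> P q \<Longrightarrow> P (p + q)"
  shows "P p"
proof -
  \<comment> \<open>The zero polynomial is a \<open>single\<close> with coefficient 0; this covers
    the empty sum and the default value of an infinite one.\<close>
  have "P (\<Sum>\<mu>\<in>S. Poly_Mapping.single \<mu> (Poly_Mapping.lookup p \<mu>))" for S
    using single[of undefined 0]
    by (induction S rule: infinite_finite_induct) (simp_all add: single add)
  then show ?thesis by (metis poly_mapping_expansion)
qed

section \<open>Degrees and supports of exponent vectors\<close>

lemma total_deg_zero [simp]: "total_deg 0 = 0"
  by (simp add: total_deg_def)

lemma total_deg_single [simp]: "total_deg (Poly_Mapping.single i a) = a"
  by (simp add: total_deg_def)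

lemma total_deg_eq_0_iff: "total_deg \<gamma> = 0 \<longleftrightarrow> \<gamma> = 0"
proof
  assume "total_deg \<gamma> = 0"
  then show "\<gamma> = 0" by (intro poly_mapping_eqI) (auto simp: total_deg_def in_keys_iff)
qed simp

lemma total_deg_add: "total_deg (a + b) = total_deg a + total_deg b"
  unfolding total_deg_def by (rule setsum_keys_plus_distrib) auto

lemma total_deg_sum: "total_deg (sum a S) = (\<Sum>s\<in>S. total_deg (a s))"
  by (induction S rule: infinite_finite_induct) (simp_all add: total_deg_add)

lemma keys_add_nat:
  fixes a b :: "'v \<Rightarrow>\<^sub>0 nat"
  shows "Poly_Mapping.keys (a + b) = Poly_Mapping.keys a \<union> Poly_Mapping.keys b"
  by (auto simp: in_keys_iff lookup_add)

lemma monomials_add: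
  assumes "a \<in> monomials n i j" "b \<in> monomials n i' j'"
  shows "a + b \<in> monomials n (i + i') (j + j')"
  using assms by (auto simp: monomials_def total_deg_add keys_add_nat)

section \<open>Evaluation as a ring homomorphism\<close>

lemma peval_add: "peval (p + q) v = peval p v + peval q v"
  unfolding peval_def by (rule setsum_keys_plus_distrib) (auto simp: algebra_simps)

lemma peval_zero [simp]: "peval 0 v = 0"
  by (simp add: peval_def)

lemma peval_single: "peval (Poly_Mapping.single \<mu> a) v =
    a * (\<Prod>i\<in>Poly_Mapping.keys \<mu>. v i ^ Poly_Mapping.lookup \<mu> i)"
  by (simp add: peval_def)

lemma peval_one [simp]: "peval 1 v = 1"
  using peval_single[of 0 1 v] by simp

lemma peval_pvar [simp]: "peval (pvar i) v = v i"
  by (simp add: pvar_def peval_single)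

lemma pvars_pvar: "pvars (pvar i) = {i}"
  by (simp add: pvars_def pvar_def)

lemma prod_pvar: "(\<Prod>i\<in>S. pvar (a i)) = Poly_Mapping.single (\<Sum>i\<in>S. Poly_Mapping.single (a i) 1) 1"
  by (induction S rule: infinite_finite_induct) (simp_all add: pvar_def mult_single)

text \<open>All three products can be taken over the union of the supports, because the added
  factors have exponent 0.\<close>

lemma monomial_value_add:
  fixes \<mu> \<nu> :: "'v \<Rightarrow>\<^sub>0 nat" and v :: "'v \<Rightarrow> complex"
  shows "(\<Prod>i\<in>Poly_Mapping.keys (\<mu> + \<nu>). v i ^ Poly_Mapping.lookup (\<mu> + \<nu>) i) =
    (\<Prod>i\<in>Poly_Mapping.keys \<mu>. v i ^ Poly_Mapping.lookup \<mu> i) *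
    (\<Prod>i\<in>Poly_Mapping.keys \<nu>. v i ^ Poly_Mapping.lookup \<nu> i)"
proof -
  let ?K = "Poly_Mapping.keys \<mu> \<union> Poly_Mapping.keys \<nu>"
  have ext: "(\<Prod>i\<in>Poly_Mapping.keys \<kappa>. v i ^ Poly_Mapping.lookup \<kappa> i) =
      (\<Prod>i\<in>?K. v i ^ Poly_Mapping.lookup \<kappa> i)" if "Poly_Mapping.keys \<kappa> \<subseteq> ?K"
    for \<kappa> :: "'v \<Rightarrow>\<^sub>0 nat"
    using that by (intro prod.mono_neutral_left) (auto simp: in_keys_iff)
  show ?thesis
    by (subst (1 2 3) ext)
       (auto simp: keys_add_nat lookup_add power_add prod.distrib)
qed

lemma peval_mult: "peval (p * q) v = peval p v * peval q v"
proof (induction p rule: poly_mapping_additive_induct)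
  case (single \<mu> a)
  show ?case
  proof (induction q rule: poly_mapping_additive_induct)
    case (single \<nu> b)
    show ?case by (simp add: mult_single peval_single monomial_value_add)
  qed (simp add: peval_add distrib_left)
qed (simp add: peval_add distrib_right)

lemma comm_ring_hom_peval: "comm_ring_hom (\<lambda>p. peval p v)"
  by unfold_locales (simp_all add: peval_add peval_mult)

lemma peval_det:
  assumes "A \<in> carrier_mat N N"
  shows "peval (Determinant.det A) v = Determinant.det (map_mat (\<lambda>p. peval p v) A)"
proof -
  interpret comm_ring_hom "\<lambda>p. peval p v" by (rule comm_ring_hom_peval)
  show ?thesis by (rule hom_det[symmetric])
qed

section \<open>Formal partial derivatives as derivations\<close>

lemma ppartial_add: "ppartial i (p + q) = ppartial i p + ppartial i q"
  unfolding ppartial_def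
  by (rule setsum_keys_plus_distrib) (auto simp: algebra_simps single_add)

lemma ppartial_zero [simp]: "ppartial i 0 = 0"
  by (simp add: ppartial_def)

lemma ppartial_sum: "ppartial i (sum p S) = (\<Sum>s\<in>S. ppartial i (p s))"
  by (induction S rule: infinite_finite_induct) (simp_all add: ppartial_add)

lemma ppartial_single: "ppartial i (Poly_Mapping.single \<mu> a) =
    Poly_Mapping.single (\<mu> - Poly_Mapping.single i 1) (of_nat (Poly_Mapping.lookup \<mu> i) * a)"
  by (simp add: ppartial_def)

lemma ppartial_pvar: "ppartial i (pvar j) = (if i = j then 1 else 0)"
  by (simp add: pvar_def ppartial_single lookup_single when_def)

text \<open>Subtraction of exponents is truncated. The unit must be available in \<mu>, since the
  left side could otherwise take it from \<nu>.\<close>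

lemma diff_single_add:
  fixes \<mu> \<nu> :: "'v \<Rightarrow>\<^sub>0 nat"
  assumes "Poly_Mapping.lookup \<mu> i \<noteq> 0"
  shows "\<mu> + \<nu> - Poly_Mapping.single i 1 = (\<mu> - Poly_Mapping.single i 1) + \<nu>"
  using assms by (intro poly_mapping_eqI) (auto simp: lookup_add lookup_minus lookup_single when_def)

lemma ppartial_mult: "ppartial i (p * q) = p * ppartial i q + ppartial i p * q"
proof -
  have *: "ppartial i (Poly_Mapping.single \<mu> a * Poly_Mapping.single \<nu> b) =
      Poly_Mapping.single \<mu> a * ppartial i (Poly_Mapping.single \<nu> b) +
      ppartial i (Poly_Mapping.single \<mu> a) * Poly_Mapping.single \<nu> b" for \<mu> \<nu> a b
  proof -
    \<comment> \<open>If variable \<open>i\<close> does not occur in \<mu>, truncation spoils the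
      exponent, but then the coefficient is 0 on both sides.\<close>
    have 1: "Poly_Mapping.single (\<mu> + \<nu> - Poly_Mapping.single i 1)
          (of_nat (Poly_Mapping.lookup \<mu> i) * (a * b)) =
        ppartial i (Poly_Mapping.single \<mu> a) * Poly_Mapping.single \<nu> b"
      by (cases "Poly_Mapping.lookup \<mu> i = 0")
         (simp_all add: diff_single_add[simplified] ppartial_single mult_single mult.assoc)
    have 2: "Poly_Mapping.single (\<mu> + \<nu> - Poly_Mapping.single i 1)
          (of_nat (Poly_Mapping.lookup \<nu> i) * (a * b)) =
        Poly_Mapping.single \<mu> a * ppartial i (Poly_Mapping.single \<nu> b)"
      using diff_single_add[of \<nu> i \<mu>]
      by (cases "Poly_Mapping.lookup \<nu> i = 0")
         (simp_all add: ppartial_single mult_single mult_ac add.commute)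
    show ?thesis
      unfolding 1[symmetric] 2[symmetric]
      by (simp add: mult_single ppartial_single lookup_add single_add[symmetric] algebra_simps)
  qed
  show ?thesis
  proof (induction p rule: poly_mapping_additive_induct)
    case (single \<mu> a)
    show ?case
    proof (induction q rule: poly_mapping_additive_induct)
      case (single \<nu> b)
      show ?case by (rule *)
    qed (simp add: ppartial_add distrib_left)
  qed (simp add: ppartial_add distrib_right distrib_left)
qed

section \<open>Determinants\<close>

text \<open>The derivation is abstract because it will be a vector field, a combination of partial
  derivatives with polynomial coefficients.\<close>

lemma derivation_prod:
  fixes D :: "'a :: comm_ring_1 \<Rightarrow> 'a"
  assumes add: "\<And>a b. D (a + b) = D a + D b"
    and mult: "\<And>a b. D (a * b) = a * D b + D a * b"
    and "finite S"
  shows "D (prod a S) = (\<Sum>s\<in>S. D (a s) * prod a (S - {s}))"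
  using \<open>finite S\<close>
proof (induction S rule: finite_induct)
  case empty
  show ?case using mult[of 1 1] by simp
next
  case (insert x S)
  have "(\<Sum>s\<in>S. D (a s) * prod a (insert x S - {s})) = a x * (\<Sum>s\<in>S. D (a s) * prod a (S - {s}))"
    unfolding sum_distrib_left
  proof (rule sum.cong)
    fix s assume s: "s \<in> S"
    then have "insert x S - {s} = insert x (S - {s})" using insert by auto
    then show "D (a s) * prod a (insert x S - {s}) = a x * (D (a s) * prod a (S - {s}))"
      using insert by (simp add: mult_ac)
  qed simp
  then show ?case using insert by (simp add: mult)
qed

text \<open>Each term of the Leibniz formula has one factor per column; grouping the terms of the
  product rule by the column that is hit gives determinants again.\<close>

lemma derivation_det:
  fixes D :: "'a :: comm_ring_1 \<Rightarrow> 'a"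
  assumes add: "\<And>a b. D (a + b) = D a + D b"
    and mult: "\<And>a b. D (a * b) = a * D b + D a * b"
    and A: "A \<in> carrier_mat N N"
  shows "D (Determinant.det A) = (\<Sum>j<N. Determinant.det
    (mat N N (\<lambda>(i, j'). if j' = j then D (A $$ (i, j)) else A $$ (i, j'))))"
proof -
  have zero: "D 0 = 0" using add[of 0 0] by simp
  have neg: "D (- a) = - D a" for a
    using add[of a "- a"] zero by (simp add: eq_neg_iff_add_eq_0 add.commute)
  have sum: "D (sum a S) = (\<Sum>s\<in>S. D (a s))" for a and S :: "(nat \<Rightarrow> nat) set"
    by (induction S rule: infinite_finite_induct) (simp_all add: zero add)
  have sgn: "D (signof p * a) = signof p * D a" for p :: "nat \<Rightarrow> nat" and a
    by (simp add: sign_def neg)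
  let ?B = "\<lambda>j. mat N N (\<lambda>(i, j'). if j' = j then D (A $$ (i, j)) else A $$ (i, j'))"
  let ?P = "{p. p permutes {0..<N}}"
  have prod: "D (\<Prod>j<N. A $$ (p j, j)) = (\<Sum>j<N. \<Prod>j'<N. ?B j $$ (p j', j'))"
    if p: "p permutes {0..<N}" for p
  proof -
    have "D (\<Prod>j<N. A $$ (p j, j)) =
        (\<Sum>j<N. D (A $$ (p j, j)) * (\<Prod>j'\<in>{..<N} - {j}. A $$ (p j', j')))"
      by (rule derivation_prod[OF add mult]) simp
    also have "\<dots> = (\<Sum>j<N. \<Prod>j'<N. ?B j $$ (p j', j'))"
    proof (rule sum.cong)
      fix j assume j: "j \<in> {..<N}"
      have lt: "p j' < N" if "j' < N" for j' using permutes_in_image[OF p, of j'] that by auto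
      show "D (A $$ (p j, j)) * (\<Prod>j'\<in>{..<N} - {j}. A $$ (p j', j')) =
          (\<Prod>j'<N. ?B j $$ (p j', j'))"
        using j by (subst prod.remove[of "{..<N}" j])
          (auto simp: lt intro!: arg_cong2[of _ _ _ _ times] prod.cong)
    qed simp
    finally show ?thesis .
  qed
  have "D (Determinant.det A) = (\<Sum>p\<in>?P. signof p * D (\<Prod>j<N. A $$ (p j, j)))"
    by (simp add: det_col[OF A] sum sgn)
  also have "\<dots> = (\<Sum>p\<in>?P. \<Sum>j<N. signof p * (\<Prod>j'<N. ?B j $$ (p j', j')))"
    by (intro sum.cong) (simp_all add: prod sum_distrib_left)
  also have "\<dots> = (\<Sum>j<N. Determinant.det (?B j))"
    by (subst sum.swap) (intro sum.cong refl det_col[symmetric], simp)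
  finally show ?thesis .
qed

text \<open>The entry \<open>v (g r + h r)\<close> in the last corner occurs nowhere else in the matrix, so its
  value can be chosen last.\<close>

lemma exists_nonsingular_hankel:
  fixes g h :: "nat \<Rightarrow> 'a :: linordered_cancel_ab_semigroup_add"
  assumes "\<And>i j. i < j \<Longrightarrow> j < r \<Longrightarrow> g i < g j" "\<And>i j. i < j \<Longrightarrow> j < r \<Longrightarrow> h i < h j"
  shows "\<exists>v :: 'a \<Rightarrow> 'b :: comm_ring_1. Determinant.det (mat r r (\<lambda>(i, j). v (g j + h i))) \<noteq> 0"
  using assms
proof (induction r)
  case 0
  show ?case by (simp add: det_dim_zero)
next
  case (Suc r)
  obtain v :: "'a \<Rightarrow> 'b" where v: "Determinant.det (mat r r (\<lambda>(i, j). v (g j + h i))) \<noteq> 0"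
    using Suc.IH Suc.prems by (meson less_Suc_eq)
  define w where "w t = v(g r + h r := t)" for t
  define A where "A t = mat (Suc r) (Suc r) (\<lambda>(i, j). w t (g j + h i))" for t
  have w: "w t (g j + h i) = v (g j + h i)" if "i < Suc r" "j < Suc r" "i < r \<or> j < r" for i j t
  proof -
    \<comment> \<open>Strict monotonicity of both sequences makes every other index sum strictly
      smaller than the corner's.\<close>
    have "h i \<le> h r" "g j \<le> g r" "i < r \<Longrightarrow> h i < h r" "j < r \<Longrightarrow> g j < g r"
      using Suc.prems that by (auto simp: less_Suc_eq intro: less_imp_le)
    then have "g j + h i < g r + h r" using that(3)
      by (auto intro: add_le_less_mono add_less_le_mono)
    then have "g j + h i \<noteq> g r + h r" by simp
    then show ?thesis by (simp add: w_def)
  qed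
  \<comment> \<open>Cofactors along the last row delete the corner, so they do not depend on
    \<open>t\<close>.\<close>
  have cof: "cofactor (A t) r j = cofactor (A 0) r j" if "j < Suc r" for t j
    unfolding cofactor_def mat_delete_def A_def
    by (rule arg_cong[where f = "\<lambda>x. _ * Determinant.det x"], rule eq_matI)
       (use that in \<open>auto simp: w\<close>)
  have corner: "cofactor (A 0) r r = Determinant.det (mat r r (\<lambda>(i, j). v (g j + h i)))"
  proof -
    have "mat_delete (A 0) r r = mat r r (\<lambda>(i, j). v (g j + h i))"
      by (rule eq_matI) (auto simp: mat_delete_def A_def w)
    then show ?thesis by (simp add: cofactor_def mult_2[symmetric] power_mult)
  qed
  have exp: "Determinant.det (A t) =
      (\<Sum>j<r. v (g j + h r) * cofactor (A 0) r j) + t * cofactor (A 0) r r" for t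
  proof -
    have "Determinant.det (A t) = (\<Sum>j<Suc r. A t $$ (r, j) * cofactor (A t) r j)"
      by (rule laplace_expansion_row) (auto simp: A_def)
    also have "\<dots> = (\<Sum>j<Suc r. w t (g j + h r) * cofactor (A 0) r j)"
      by (intro sum.cong refl arg_cong2[of _ _ _ _ times] cof) (simp_all add: A_def)
    also have "\<dots> = (\<Sum>j<r. v (g j + h r) * cofactor (A 0) r j) + t * cofactor (A 0) r r"
      by (simp add: w) (simp add: w_def)
    finally show ?thesis .
  qed
  \<comment> \<open>The determinant is affine in \<open>t\<close> with nonzero slope, so it cannot
    vanish at both 0 and 1.\<close>
  have "Determinant.det (A 0) \<noteq> 0 \<or> Determinant.det (A 1) \<noteq> 0"
    using v corner exp[of 0] exp[of 1] by auto
  then show ?case unfolding A_def by blast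
qed

section \<open>Linear relations of Hankel type between the partial derivatives\<close>

text \<open>What both conclusions need from the Pade matrix: \<open>g\<close> lists the \<gamma> of
  degree k, \<open>h\<close> the selected \<delta>, and \<open>c\<close> the kernel vector. The
  sequences increase in the linear order on exponents, which is compatible with addition, so
  extremal index sums are attained only once.\<close>

locale hankel_relation =
  fixes f :: "exponent cpoly" and ws :: "exponent list" and N :: nat
    and g h :: "nat \<Rightarrow> exponent" and c :: "nat \<Rightarrow> exponent cpoly"
  assumes N: "N > 0"
    and g_mono: "\<And>i j. i < j \<Longrightarrow> j < N \<Longrightarrow> g i < g j"
    and h_mono: "\<And>i j. i < j \<Longrightarrow> j < N \<Longrightarrow> h i < h j"
    and ws: "\<And>i j. i < N \<Longrightarrow> j < N \<Longrightarrow> g j + h i \<in> set ws"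
    and c0: "c 0 \<noteq> 0"
    and relation: "\<And>i. i < N \<Longrightarrow> (\<Sum>j<N. ppartial (g j + h i) f * c j) = 0"
begin

definition M :: "exponent cpoly mat" where
  "M = mat N N (\<lambda>(i, j). ppartial (g j + h i) f)"

lemma M_carrier: "M \<in> carrier_mat N N"
  by (simp add: M_def)

lemma det_M: "Determinant.det M = 0"
proof -
  have "M *\<^sub>v vec N c = 0\<^sub>v N"
    by (rule eq_vecI) (simp_all add: M_def scalar_prod_def relation[unfolded lessThan_atLeast0])
  moreover have "vec N c \<noteq> 0\<^sub>v N"
  proof
    assume "vec N c = 0\<^sub>v N"
    then have "vec N c $ 0 = 0\<^sub>v N $ 0" by simp
    then show False using N c0 by simp
  qed
  ultimately show ?thesis
    using det_0_iff_vec_prod_zero[OF M_carrier] vec_carrier by blast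
qed

text \<open>The equation for the polar image: substituting the partial derivatives of
  \<open>f\<close> for the variables turns it into \<open>det M\<close>.\<close>

definition G :: "exponent cpoly" where
  "G = Determinant.det (mat N N (\<lambda>(i, j). pvar (g j + h i)))"

lemma peval_G: "peval G v = Determinant.det (mat N N (\<lambda>(i, j). v (g j + h i)))"
proof -
  have "map_mat (\<lambda>p. peval p v) (mat N N (\<lambda>(i, j). pvar (g j + h i))) =
      mat N N (\<lambda>(i, j). v (g j + h i))"
    by (rule eq_matI) auto
  then show ?thesis
    unfolding G_def by (simp add: peval_det[of _ N])
qed

text \<open>Every monomial of \<open>G\<close> comes from some term of the Leibniz expansion. This
  yields both the degree \<open>N\<close> and the variables that can occur.\<close>

lemma keys_G:
  assumes "\<mu> \<in> Poly_Mapping.keys G"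
  shows "\<exists>p. p permutes {0..<N} \<and> \<mu> = (\<Sum>i = 0..<N. Poly_Mapping.single (g (p i) + h i) 1)"
proof -
  let ?A = "mat N N (\<lambda>(i, j). pvar (g j + h i)) :: exponent cpoly mat"
  have "Determinant.det ?A = (\<Sum>p\<in>{p. p permutes {0..<N}}. signof p * (\<Prod>i = 0..<N. ?A $$ (i, p i)))"
    by (rule det_def') simp
  then have "\<mu> \<in> (\<Union>p\<in>{p. p permutes {0..<N}}.
      Poly_Mapping.keys (signof p * (\<Prod>i = 0..<N. ?A $$ (i, p i))))"
    using assms keys_sum unfolding G_def by fastforce
  then obtain p where p: "p permutes {0..<N}"
    and \<mu>: "\<mu> \<in> Poly_Mapping.keys (signof p * (\<Prod>i = 0..<N. ?A $$ (i, p i)))"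
    by auto
  have "(\<Prod>i = 0..<N. ?A $$ (i, p i)) = (\<Prod>i = 0..<N. pvar (g (p i) + h i))"
    using permutes_in_image[OF p] by (intro prod.cong) auto
  then have "\<mu> \<in> Poly_Mapping.keys (Poly_Mapping.single (\<Sum>i = 0..<N. Poly_Mapping.single (g (p i) + h i) (1 :: nat)) (1 :: complex))"
    using \<mu> by (auto simp: prod_pvar sign_def in_keys_iff lookup_single when_def split: if_splits)
  then show ?thesis using p by auto
qed

lemma homogeneous_G: "homogeneous G"
  unfolding homogeneous_def
proof (intro exI ballI)
  fix \<mu> assume "\<mu> \<in> Poly_Mapping.keys G"
  then show "total_deg \<mu> = N" by (auto dest!: keys_G simp: total_deg_sum)
qed

lemma pvars_G: "pvars G \<subseteq> set ws"
proof
  fix x assume "x \<in> pvars G"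
  then obtain \<mu> where \<mu>: "\<mu> \<in> Poly_Mapping.keys G" "x \<in> Poly_Mapping.keys \<mu>"
    by (auto simp: pvars_def)
  obtain p where p: "p permutes {0..<N}"
    "\<mu> = (\<Sum>i = 0..<N. Poly_Mapping.single (g (p i) + h i) 1)"
    using keys_G[OF \<mu>(1)] by auto
  have "x \<in> (\<Union>i\<in>{0..<N}. Poly_Mapping.keys (Poly_Mapping.single (g (p i) + h i) (1 :: nat)))"
  proof (rule ccontr)
    assume "\<not> ?thesis"
    then have "Poly_Mapping.lookup \<mu> x = 0"
      by (auto simp: p(2) lookup_sum lookup_single when_def)
    then show False using \<mu>(2) by (simp add: in_keys_iff)
  qed
  then show "x \<in> set ws" using permutes_in_image[OF p(1)] ws by auto
qed

lemma not_dense: "\<not> zariski_dense (set ws) (polar_image (set ws) f)"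
proof
  assume dense: "zariski_dense (set ws) (polar_image (set ws) f)"
  let ?Z = "zero_locus (set ws) {G}"
  have closed: "zariski_closed (set ws) ?Z"
    unfolding zariski_closed_def using homogeneous_G pvars_G by blast
  have "polar_image (set ws) f \<subseteq> ?Z"
  proof
    fix x assume "x \<in> polar_image (set ws) f"
    then obtain v where x: "x = proj_point (set ws) (polar_vector (set ws) f v)"
      and nz: "polar_vector (set ws) f v \<in> nonzero_vectors (set ws)"
      by (auto simp: polar_image_def)
    let ?u = "polar_vector (set ws) f v"
    have "peval G w = 0" if "w \<in> x" for w
    proof -
      have "(?u, w) \<in> scaling_rel (set ws)" using that by (simp add: x proj_point_def)
      then obtain a where a: "\<forall>i. w i = a * ?u i" by (rule scaling_relE)
      \<comment> \<open>Any representative \<open>w\<close> of the point is a multiple of the polar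
        vector, so its matrix is a multiple of \<open>M\<close> evaluated at \<open>v\<close>, which
        is singular.\<close>
      have "mat N N (\<lambda>(i, j). w (g j + h i)) = a \<cdot>\<^sub>m map_mat (\<lambda>p. peval p v) M"
        by (rule eq_matI) (auto simp: a polar_vector_def M_def ws)
      then show ?thesis
        by (simp add: peval_G peval_det[OF M_carrier, symmetric] det_M)
    qed
    moreover have "x \<in> proj_space (set ws)"
      unfolding x proj_point_def proj_space_def using nz by (rule quotientI)
    ultimately show "x \<in> ?Z" by (simp add: zero_locus_def)
  qed
  then have sub: "proj_space (set ws) \<subseteq> ?Z"
    using dense closed unfolding zariski_dense_def zariski_closure_def by (metis hull_minimal)
  obtain v :: "exponent \<Rightarrow> complex"
    where v: "Determinant.det (mat N N (\<lambda>(i, j). v (g j + h i))) \<noteq> 0"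
    using exists_nonsingular_hankel[of N g h] g_mono h_mono by blast
  \<comment> \<open>Coordinate vectors must vanish outside \<open>ws\<close>; this truncation leaves
    all entries of the matrix unchanged.\<close>
  define w where "w x = (if x \<in> set ws then v x else 0)" for x
  have "mat N N (\<lambda>(i, j). w (g j + h i)) = mat N N (\<lambda>(i, j). v (g j + h i))"
    by (rule eq_matI) (auto simp: w_def ws)
  then have Gw: "peval G w \<noteq> 0" using v by (simp add: peval_G)
  have "\<exists>x\<in>set ws. w x \<noteq> 0"
  proof (rule ccontr)
    assume "\<not> ?thesis"
    then have "w = (\<lambda>_. 0)" by (auto simp: w_def)
    \<comment> \<open>Written as a multiple by 0, the matrix has a determinant with factor
      \<open>0 ^ N\<close>, which is 0 as \<open>N > 0\<close>.\<close>
    then have "mat N N (\<lambda>(i, j). w (g j + h i)) = 0 \<cdot>\<^sub>m mat N N (\<lambda>_. 0)"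
      by (intro eq_matI) auto
    then show False using Gw N by (simp add: peval_G)
  qed
  then have nz: "w \<in> nonzero_vectors (set ws)" by (auto simp: nonzero_vectors_def w_def)
  then have "proj_point (set ws) w \<in> proj_space (set ws)"
    unfolding proj_point_def proj_space_def by (rule quotientI)
  moreover have "w \<in> proj_point (set ws) w"
    unfolding proj_point_def by (rule equiv_class_self[OF equiv_scaling_rel nz])
  ultimately show False using sub Gw by (auto simp: zero_locus_def)
qed

text \<open>Let \<open>y\<close> be a left kernel vector of \<open>M\<close>. Differentiating \<open>M c = 0\<close> and multiplying by \<open>y\<close>
  eliminates the derivatives of \<open>c\<close>, and what remains says that the vector with \<open>\<epsilon>\<close>-coordinate
  \<open>\<Sum> {y i * c j | g j + h i = \<epsilon>}\<close> lies in the kernel of the Hessian. Its coordinate at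
  \<open>\<epsilon> = g 0 + h i\<^sub>0\<close>, where \<open>i\<^sub>0\<close> is the first index with \<open>y i\<^sub>0 \<noteq> 0\<close>, is a single product.\<close>

lemma hessian_singular:
  assumes "distinct ws"
  shows "Determinant.det (hessian_matrix ws f) = 0"
proof -
  have "Determinant.det M\<^sup>T = 0" using det_transpose[OF M_carrier] det_M by simp
  then obtain y where y: "y \<in> carrier_vec N" "y \<noteq> 0\<^sub>v N" "M\<^sup>T *\<^sub>v y = 0\<^sub>v N"
    using det_0_iff_vec_prod_zero[of "M\<^sup>T" N] M_carrier by auto
  have ker: "(\<Sum>i<N. y $ i * ppartial (g j + h i) f) = 0" if "j < N" for j
  proof -
    have "(M\<^sup>T *\<^sub>v y) $ j = 0" using y that by simp
    then show ?thesis using that y(1) M_carrier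
      by (simp add: M_def scalar_prod_def lessThan_atLeast0 mult.commute)
  qed
  let ?L = "length ws"
  define z where "z \<epsilon> = (\<Sum>i<N. \<Sum>j<N. if g j + h i = \<epsilon> then y $ i * c j else 0)" for \<epsilon>
  \<comment> \<open>Since \<open>ws\<close> is distinct, each of its exponents sits at exactly one
    position.\<close>
  have pick: "(\<Sum>l<?L. F (ws ! l) * (if \<epsilon> = ws ! l then a else 0)) = F \<epsilon> * a"
    if "\<epsilon> \<in> set ws" for F :: "exponent \<Rightarrow> exponent cpoly" and a \<epsilon>
  proof -
    obtain l0 where l0: "l0 < ?L" "ws ! l0 = \<epsilon>" using \<open>\<epsilon> \<in> set ws\<close> by (auto simp: in_set_conv_nth)
    have "(\<Sum>l<?L. F (ws ! l) * (if \<epsilon> = ws ! l then a else 0)) =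
        (\<Sum>l<?L. if l = l0 then F \<epsilon> * a else 0)"
      using l0 assms by (intro sum.cong) (auto simp: nth_eq_iff_index_eq)
    then show ?thesis using l0 by simp
  qed
  have Hz: "(\<Sum>l<?L. ppartial \<omega> (ppartial (ws ! l) f) * z (ws ! l)) = 0" for \<omega>
  proof -
    let ?F = "\<lambda>\<epsilon>. ppartial \<omega> (ppartial \<epsilon> f)"
    have "(\<Sum>l<?L. ?F (ws ! l) * z (ws ! l)) =
        (\<Sum>i<N. \<Sum>j<N. \<Sum>l<?L. ?F (ws ! l) * (if g j + h i = ws ! l then y $ i * c j else 0))"
      unfolding z_def sum_distrib_left
      by (subst sum.swap, rule sum.cong[OF refl], rule sum.swap)
    also have "\<dots> = (\<Sum>i<N. \<Sum>j<N. ?F (g j + h i) * (y $ i * c j))"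
      by (intro sum.cong refl pick ws) auto
    also have "\<dots> = (\<Sum>i<N. y $ i * (\<Sum>j<N. ?F (g j + h i) * c j))"
      by (simp add: sum_distrib_left mult_ac)
    also have "\<dots> = (\<Sum>i<N. y $ i * - (\<Sum>j<N. ppartial (g j + h i) f * ppartial \<omega> (c j)))"
    proof (intro sum.cong refl arg_cong2[of _ _ _ _ times])
      fix i assume "i \<in> {..<N}"
      then have "ppartial \<omega> (\<Sum>j<N. ppartial (g j + h i) f * c j) = 0" by (simp add: relation)
      then show "(\<Sum>j<N. ?F (g j + h i) * c j) = - (\<Sum>j<N. ppartial (g j + h i) f * ppartial \<omega> (c j))"
        by (simp add: ppartial_sum ppartial_mult sum.distrib eq_neg_iff_add_eq_0 add.commute)
    qed
    also have "\<dots> = - (\<Sum>j<N. (\<Sum>i<N. y $ i * ppartial (g j + h i) f) * ppartial \<omega> (c j))"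
      unfolding sum_distrib_right by (subst sum.swap) (simp add: sum_distrib_left sum_negf mult_ac)
    also have "\<dots> = 0" by (simp add: ker)
    finally show ?thesis .
  qed
  have "\<exists>i. i < N \<and> y $ i \<noteq> 0"
    using y(1,2) by (metis carrier_vecD eq_vecI index_zero_vec)
  then obtain i0 where i0: "i0 < N" "y $ i0 \<noteq> 0" "\<And>i. i < i0 \<Longrightarrow> y $ i = 0"
    using exists_least_iff[of "\<lambda>i. i < N \<and> y $ i \<noteq> 0"] by (metis less_trans)
  have "z (g 0 + h i0) = (\<Sum>i<N. \<Sum>j<N. if j = 0 then if i = i0 then y $ i0 * c 0 else 0 else 0)"
    unfolding z_def
  proof (intro sum.cong refl)
    fix i j assume ij: "i \<in> {..<N}" "j \<in> {..<N}"
    show "(if g j + h i = g 0 + h i0 then y $ i * c j else 0) =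
        (if j = 0 then if i = i0 then y $ i0 * c 0 else 0 else 0)"
    proof (cases "i < i0 \<or> j = 0 \<and> i = i0")
      case True
      then show ?thesis using i0(3) by auto
    next
      case False
      \<comment> \<open>Terms with \<open>i < i0\<close> vanish by the choice of \<open>i0\<close>;
        any other pair except \<open>(i0, 0)\<close> has a strictly larger index sum.\<close>
      have "h i0 \<le> h i" "g 0 \<le> g j" "i \<noteq> i0 \<Longrightarrow> h i0 < h i" "j \<noteq> 0 \<Longrightarrow> g 0 < g j"
        using False ij h_mono[of i0 i] g_mono[of 0 j] by (cases "i = i0"; cases "j = 0"; auto)+
      then have "g 0 + h i0 < g j + h i" using False
        by (metis add_le_less_mono add_less_le_mono)
      then show ?thesis using False by auto
    qed
  qed
  also have "\<dots> = y $ i0 * c 0" using N i0(1) by simp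
  finally have z0: "z (g 0 + h i0) \<noteq> 0" using i0(2) c0 by simp
  obtain l0 where l0: "l0 < ?L" "ws ! l0 = g 0 + h i0"
    using ws[of i0 0] N i0(1) by (auto simp: in_set_conv_nth)
  let ?z = "vec ?L (\<lambda>l. z (ws ! l))"
  have H: "hessian_matrix ws f \<in> carrier_mat ?L ?L" by (simp add: hessian_matrix_def)
  have "hessian_matrix ws f *\<^sub>v ?z = 0\<^sub>v ?L"
    by (rule eq_vecI) (simp_all add: hessian_matrix_def scalar_prod_def Hz[unfolded lessThan_atLeast0])
  moreover have "?z \<noteq> 0\<^sub>v ?L"
  proof
    assume "?z = 0\<^sub>v ?L"
    then have "?z $ l0 = 0\<^sub>v ?L $ l0" by simp
    then show False using l0 z0 by simp
  qed
  ultimately show ?thesis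
    using det_0_iff_vec_prod_zero[OF H] vec_carrier by blast
qed

end

section \<open>Pade matrices\<close>

text \<open>Divisibility is restated through a cofactor \<gamma>, which avoids truncated subtraction
  when shifts by \<delta> are compared.\<close>

lemma pade_matrix_index:
  assumes "i < length rs" "j < length cs"
  shows "pade_matrix rs cs $$ (i, j) =
    (if \<exists>\<gamma>. rs ! i = \<gamma> + cs ! j then pvar (rs ! i - cs ! j) else 0)"
proof -
  have "(\<forall>k. Poly_Mapping.lookup (cs ! j) k \<le> Poly_Mapping.lookup (rs ! i) k) \<longleftrightarrow>
      (\<exists>\<gamma>. rs ! i = \<gamma> + cs ! j)"
  proof
    assume *: "\<forall>k. Poly_Mapping.lookup (cs ! j) k \<le> Poly_Mapping.lookup (rs ! i) k"
    have "rs ! i = (rs ! i - cs ! j) + cs ! j"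
      by (rule poly_mapping_eqI) (simp add: lookup_add lookup_minus *)
    then show "\<exists>\<gamma>. rs ! i = \<gamma> + cs ! j" ..
  qed (auto simp: lookup_add)
  then show ?thesis using assms by (simp add: pade_matrix_def)
qed

text \<open>The polynomial vector field \<open>\<Sum>\<gamma>. c\<^sub>\<gamma> \<partial>/\<partial>c\<^bsub>\<gamma>+\<delta>\<^esub>\<close> maps the column \<open>x\<^sup>\<beta>\<close> of the Pade matrix
  to the column \<open>x\<^bsup>\<beta>+\<delta>\<^esup>\<close> or to zero, hence it annihilates the determinant.\<close>

lemma pade_det_relation:
  assumes rs: "set rs = monomials n m m"
    and cs: "set cs = monomials n 0 e"
    and sq: "length rs = length cs"
    and k: "k + e = m" and fin: "finite (monomials n k k)"
    and \<delta>: "\<delta> \<in> monomials n 1 e"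
  shows "(\<Sum>\<gamma>\<in>monomials n k k.
    ppartial (\<gamma> + \<delta>) (Determinant.det (pade_matrix rs cs)) * pvar \<gamma>) = 0"
proof -
  let ?A = "pade_matrix rs cs" and ?N = "length cs" and ?S = "monomials n k k"
  define D where "D p = (\<Sum>\<gamma>\<in>?S. ppartial (\<gamma> + \<delta>) p * pvar \<gamma>)" for p :: "exponent cpoly"
  have A: "?A \<in> carrier_mat ?N ?N" by (simp add: pade_matrix_def sq)
  have "D (Determinant.det ?A) = (\<Sum>j<?N. Determinant.det
    (mat ?N ?N (\<lambda>(i, j'). if j' = j then D (?A $$ (i, j)) else ?A $$ (i, j'))))"
  proof (rule derivation_det[OF _ _ A])
    show "D (a + b) = D a + D b" for a b
      by (simp add: D_def ppartial_add distrib_right sum.distrib)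
    show "D (a * b) = a * D b + D a * b" for a b
      by (simp add: D_def ppartial_mult distrib_right distrib_left sum.distrib sum_distrib_left
          sum_distrib_right mult_ac)
  qed
  also have "\<dots> = 0"
  proof (rule sum.neutral, rule ballI)
    fix j assume "j \<in> {..<?N}"
    then have j: "j < ?N" by simp
    let ?\<beta> = "cs ! j"
    have \<beta>: "?\<beta> \<in> monomials n 0 e" using j cs nth_mem by blast
    let ?B = "mat ?N ?N (\<lambda>(i, j'). if j' = j then D (?A $$ (i, j)) else ?A $$ (i, j'))"
    have B: "?B \<in> carrier_mat ?N ?N" by simp
    \<comment> \<open>The field acts on an entry with variable index \<alpha> - \<beta> by picking
      the \<gamma> with \<gamma> + \<delta> = \<alpha> - \<beta>; zero entries give zero on both
      sides.\<close>
    have DA: "D (?A $$ (i, j)) = (\<Sum>\<gamma>\<in>?S. if rs ! i = \<gamma> + (?\<beta> + \<delta>) then pvar \<gamma> else 0)"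
      if i: "i < ?N" for i
    proof (cases "\<exists>\<gamma>. rs ! i = \<gamma> + ?\<beta>")
      case True
      then obtain \<gamma>0 where \<gamma>0: "rs ! i = \<gamma>0 + ?\<beta>" ..
      then have "?A $$ (i, j) = pvar \<gamma>0" using i j sq by (simp add: pade_matrix_index)
      moreover have "rs ! i = \<gamma> + (?\<beta> + \<delta>) \<longleftrightarrow> \<gamma> + \<delta> = \<gamma>0" for \<gamma>
      proof -
        have "\<gamma> + (?\<beta> + \<delta>) = (\<gamma> + \<delta>) + ?\<beta>" by (simp add: add_ac)
        then show ?thesis unfolding \<gamma>0 by auto
      qed
      ultimately show ?thesis
        by (auto simp: D_def ppartial_pvar intro!: sum.cong)
    next
      case False
      then have "?A $$ (i, j) = 0" using i j sq by (simp add: pade_matrix_index)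
      moreover have "rs ! i \<noteq> \<gamma> + (?\<beta> + \<delta>)" for \<gamma>
      proof
        assume "rs ! i = \<gamma> + (?\<beta> + \<delta>)"
        then have "rs ! i = (\<gamma> + \<delta>) + ?\<beta>" by (simp add: add_ac)
        then show False using False by blast
      qed
      ultimately show ?thesis by (simp add: D_def)
    qed
    have row: "total_deg (rs ! i) = m" "Poly_Mapping.keys (rs ! i) \<subseteq> {..<n}" if "i < ?N" for i
      using that rs sq nth_mem[of i rs] by (auto simp: monomials_def)
    show "Determinant.det ?B = 0"
    \<comment> \<open>Rows have degree \<open>m = k + e\<close> and the field only involves \<gamma>
      of degree \<open>k\<close>. So in degree \<open>e\<close> the differentiated column repeats
      the column of \<beta> + \<delta>, distinct from that of \<beta> because \<delta> is nonzero;
      in any other degree it is zero.\<close>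
    proof (cases "total_deg (?\<beta> + \<delta>) = e")
      case True
      have "?\<beta> + \<delta> \<in> set cs"
        using True monomials_add[OF \<beta> \<delta>] unfolding cs by (auto simp: monomials_def)
      then obtain j' where j': "j' < ?N" "cs ! j' = ?\<beta> + \<delta>"
        by (auto simp: in_set_conv_nth)
      have "\<delta> \<noteq> 0" using \<delta> by (auto simp: monomials_def)
      then have ne: "j' \<noteq> j" using j'(2) by auto
      have "D (?A $$ (i, j)) = ?A $$ (i, j')" if i: "i < ?N" for i
      proof (cases "\<exists>\<gamma>. rs ! i = \<gamma> + (?\<beta> + \<delta>)")
        case True
        then obtain \<gamma>0 where \<gamma>0: "rs ! i = \<gamma>0 + (?\<beta> + \<delta>)" ..
        have "total_deg \<gamma>0 + e = k + e"
          using row(1)[OF i] \<open>total_deg (?\<beta> + \<delta>) = e\<close> k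
          by (simp only: \<gamma>0 total_deg_add[of \<gamma>0])
        moreover have "Poly_Mapping.keys \<gamma>0 \<subseteq> {..<n}"
          using row(2)[OF i] by (simp only: \<gamma>0 keys_add_nat) simp
        ultimately        have mem: "\<gamma>0 \<in> ?S" by (simp add: monomials_def)
        have "D (?A $$ (i, j)) = (\<Sum>\<gamma>\<in>?S. if \<gamma>0 = \<gamma> then pvar \<gamma> else 0)"
          unfolding DA[OF i] \<gamma>0 by (intro sum.cong) auto
        also have "\<dots> = pvar \<gamma>0" using mem fin by simp
        also have "\<dots> = ?A $$ (i, j')"
        proof -
          have "?A $$ (i, j') = pvar (rs ! i - cs ! j')"
            using i j' sq \<gamma>0 by (subst pade_matrix_index) auto
          also have "rs ! i - cs ! j' = \<gamma>0" by (simp only: \<gamma>0 j'(2) add_diff_cancel_right')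
          finally show ?thesis ..
        qed
        finally show ?thesis .
      next
        case False
        then have "?A $$ (i, j') = 0" using i j' sq by (subst pade_matrix_index) auto
        moreover have "D (?A $$ (i, j)) = 0"
          unfolding DA[OF i] using False by (intro sum.neutral) auto
        ultimately show ?thesis by simp
      qed
      then have "col ?B j = col ?B j'"
        using j j'(1) ne by (intro eq_vecI) auto
      then show ?thesis
        using det_identical_columns[OF B ne[symmetric] j j'(1)] by simp
    next
      case False
      have "D (?A $$ (i, j)) = 0" if i: "i < ?N" for i
        unfolding DA[OF i]
      proof (rule sum.neutral, rule ballI)
        fix \<gamma> assume "\<gamma> \<in> ?S"
        then have "rs ! i \<noteq> \<gamma> + (?\<beta> + \<delta>)"
          using row(1)[OF i] False k by (auto simp: monomials_def total_deg_add)
        then show "(if rs ! i = \<gamma> + (?\<beta> + \<delta>) then pvar \<gamma> else 0) = 0" by simp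
      qed
      then show ?thesis
        unfolding laplace_expansion_column[OF B j] using j by (intro sum.neutral) auto
    qed
  qed
  finally show ?thesis by (simp add: D_def)
qed

text \<open>Multiplying \<epsilon> by a power of the first variable brings it to degree
  \<open>m\<close>; that power has degree at most \<open>e\<close>, so it indexes a column.\<close>

lemma pade_matrix_vars:
  assumes rs: "set rs = monomials n m m" and cs: "set cs = monomials n 0 e"
    and "n > 0" and \<epsilon>: "\<epsilon> \<in> monomials n (m - e) m"
  shows "\<epsilon> \<in> matrix_vars (pade_matrix rs cs)"
proof -
  define \<beta> :: exponent where "\<beta> = Poly_Mapping.single 0 (m - total_deg \<epsilon>)"
  have "\<beta> \<in> set cs" using \<epsilon> \<open>n > 0\<close> unfolding cs by (auto simp: \<beta>_def monomials_def)
  then obtain j where j: "j < length cs" "cs ! j = \<beta>" by (auto simp: in_set_conv_nth)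
  have "\<epsilon> + \<beta> \<in> set rs"
    using \<epsilon> \<open>n > 0\<close> unfolding rs
    by (auto simp: \<beta>_def monomials_def keys_add_nat total_deg_add split: if_splits)
  then obtain i where i: "i < length rs" "rs ! i = \<epsilon> + \<beta>" by (auto simp: in_set_conv_nth)
  have "pade_matrix rs cs $$ (i, j) = pvar \<epsilon>"
    using i j by (simp add: pade_matrix_index)
  moreover have "pade_matrix rs cs $$ (i, j) \<in> elements_mat (pade_matrix rs cs)"
    using i(1) j(1) by (intro elements_matI[of _ "length rs" "length cs"]) (auto simp: pade_matrix_def)
  ultimately show ?thesis
    unfolding matrix_vars_def by (intro UN_I[of "pvar \<epsilon>"]) (simp_all add: pvars_pvar)
qed

section \<open>Monomial counts for a square nonsingular Pade matrix, and the conclusion\<close>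

theorem theorem4p4:
  fixes n d e m :: nat
    and rs cs ws :: "exponent list"
    and f :: "exponent cpoly"
  assumes "n \<ge> 2"
    and "m = d + 1"
    and "distinct rs" "set rs = monomials n (d + 1) m"
    and "distinct cs" "set cs = monomials n 0 e"
    and "square_mat (pade_matrix rs cs)"
    and "f = Determinant.det (pade_matrix rs cs)"
    and "f \<noteq> 0"
    and "distinct ws" "set ws = matrix_vars (pade_matrix rs cs)"
    and "taylor_variety n d e m = zero_locus (monomials n 0 m) {f}"
  shows "\<not> zariski_dense (set ws) (polar_image (set ws) f) \<and>
         Determinant.det (hessian_matrix ws f) = 0"
proof -
  have rs: "set rs = monomials n m m" using assms by simp
  have cs: "set cs = monomials n 0 e" by fact
  have sq: "length rs = length cs"
    using assms(7) by (simp add: pade_matrix_def)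
  have finm: "finite (monomials n m m)" by (simp flip: rs)
  have fine: "finite (monomials n 0 e)" by (simp flip: cs)
  have card: "card (monomials n m m) = card (monomials n 0 e)"
    using sq assms(3,5) rs cs by (metis distinct_card)
  let ?x = "\<lambda>i a. Poly_Mapping.single i a :: exponent"
  have x01: "?x 0 a \<in> monomials n a a" "?x 1 a \<in> monomials n a a" for a
    using \<open>n \<ge> 2\<close> by (auto simp: monomials_def)
  have x_ne: "?x 0 m \<noteq> ?x 1 m"
  proof
    assume "?x 0 m = ?x 1 m"
    then have "Poly_Mapping.lookup (?x 0 m) 0 = Poly_Mapping.lookup (?x 1 m) 0" by simp
    then show False using \<open>m = d + 1\<close> by (simp add: lookup_single when_def)
  qed
  \<comment> \<open>With \<open>e = 0\<close> there is a single column, but the pure powers of two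
    different variables give two rows.\<close>
  have e: "e \<noteq> 0"
  proof
    assume "e = 0"
    then have "monomials n 0 e \<subseteq> {0}"
      by (auto simp: monomials_def total_deg_eq_0_iff)
    then have "card (monomials n 0 e) \<le> card {0 :: exponent}" by (intro card_mono) simp_all
    moreover have "card {?x 0 m, ?x 1 m} \<le> card (monomials n m m)"
      by (rule card_mono[OF finm]) (use x01 in simp)
    ultimately show False using card x_ne by simp
  qed
  \<comment> \<open>Otherwise the column of a pure power of degree \<open>e\<close> divides no row
    monomial, and this zero column forces \<open>f = 0\<close>.\<close>
  have em: "e \<le> m"
  proof (rule ccontr)
    assume "\<not> e \<le> m"
    have "?x 0 e \<in> set cs" using \<open>n \<ge> 2\<close> unfolding cs by (simp add: monomials_def)
    then obtain j where j: "j < length cs" "cs ! j = ?x 0 e" by (auto simp: in_set_conv_nth)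
    have "pade_matrix rs cs $$ (i, j) = 0" if i: "i < length cs" for i
    proof -
      have "total_deg (rs ! i) = m"
        using i rs sq nth_mem[of i rs] by (auto simp: monomials_def)
      then have "rs ! i \<noteq> \<gamma> + cs ! j" for \<gamma>
        using \<open>\<not> e \<le> m\<close> j(2) by (auto simp: total_deg_add)
      then show ?thesis using i j sq by (simp add: pade_matrix_index)
    qed
    then have "Determinant.det (pade_matrix rs cs) = 0"
      by (subst laplace_expansion_column[OF _ j(1)])
         (auto simp: pade_matrix_def[of rs cs] sq intro!: sum.neutral)
    then show False using assms(8,9) by simp
  qed
  define k where "k = m - e"
  have k: "k + e = m" using em by (simp add: k_def)
  let ?S = "monomials n k k" and ?T = "monomials n 1 e"
  \<comment> \<open>Multiplication by the \<open>e\<close>-th power of the first variable embeds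
    \<open>?S\<close> into the row monomials and misses the pure power of the second variable. Hence
    \<open>?S\<close> has fewer elements than there are rows, equivalently columns, and
    \<open>?T\<close> is the column set without the monomial 1.\<close>
  have inj: "inj_on (\<lambda>\<gamma>. \<gamma> + ?x 0 e) ?S" by (auto intro: inj_onI)
  have x1_notin: "?x 1 m \<noteq> \<gamma> + ?x 0 e" for \<gamma>
  proof
    assume "?x 1 m = \<gamma> + ?x 0 e"
    then have "Poly_Mapping.lookup (?x 1 m) 0 = Poly_Mapping.lookup (\<gamma> + ?x 0 e) 0" by simp
    then show False using e by (simp add: lookup_add lookup_single when_def)
  qed
  have img: "(\<lambda>\<gamma>. \<gamma> + ?x 0 e) ` ?S \<subseteq> monomials n m m - {?x 1 m}"
  proof (rule image_subsetI)
    fix \<gamma> assume "\<gamma> \<in> ?S"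
    from monomials_add[OF this x01(1)[of e]] show "\<gamma> + ?x 0 e \<in> monomials n m m - {?x 1 m}"
      using x1_notin[of \<gamma>] unfolding k by force
  qed
  have finS: "finite ?S" using inj_on_finite[OF inj img] finm by simp
  have "?T = monomials n 0 e - {0}"
    by (auto simp: monomials_def Suc_le_eq total_deg_eq_0_iff simp flip: neq0_conv)
  moreover have "0 \<in> monomials n 0 e" by (simp add: monomials_def)
  ultimately have finT: "finite ?T" and cardT: "card ?T = card (monomials n 0 e) - 1"
    using fine by simp_all
  have "card ?S \<le> card (monomials n m m - {?x 1 m})"
    by (rule card_inj_on_le[OF inj img]) (simp add: finm)
  also have "\<dots> = card ?T" using x01(2)[of m] finm card cardT by simp
  finally have cardST: "card ?S \<le> card ?T" .
  \<comment> \<open>Sorting supplies the strict monotonicity; only the first \<open>N\<close>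
    entries of \<open>hs\<close> serve as \<delta>.\<close>
  define gs where "gs = sorted_list_of_set ?S"
  define hs where "hs = sorted_list_of_set ?T"
  define N where "N = card ?S"
  have lg: "length gs = N" and lh: "N \<le> length hs" using cardST by (simp_all add: gs_def hs_def N_def)
  have setg: "set gs = ?S" "distinct gs" using finS by (simp_all add: gs_def)
  have seth: "set hs = ?T" using finT by (simp add: hs_def)
  interpret hankel_relation f ws N "\<lambda>i. gs ! i" "\<lambda>i. hs ! i" "\<lambda>i. pvar (gs ! i)"
  proof
    show "N > 0" using x01(1)[of k] finS by (auto simp: N_def card_gt_0_iff)
    show "gs ! i < gs ! j" if "i < j" "j < N" for i j
      using that lg strict_sorted_list_of_set[of ?S] unfolding gs_def
      by (simp add: sorted_wrt_iff_nth_less)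
    show "hs ! i < hs ! j" if "i < j" "j < N" for i j
      using that lh strict_sorted_list_of_set[of ?T] unfolding hs_def
      by (simp add: sorted_wrt_iff_nth_less)
    show "gs ! j + hs ! i \<in> set ws" if "i < N" "j < N" for i j
    proof -
      have "gs ! j \<in> ?S" "hs ! i \<in> ?T" using that lg lh setg(1) seth nth_mem by auto
      from monomials_add[OF this] have "gs ! j + hs ! i \<in> monomials n (m - e) m"
        using k by (auto simp: monomials_def)
      then show ?thesis
        unfolding assms(11) using pade_matrix_vars[OF rs cs] \<open>n \<ge> 2\<close> by simp
    qed
    show "pvar (gs ! 0) \<noteq> 0" by (metis pvars_pvar pvars_def keys_zero UN_empty insert_not_empty)
    show "(\<Sum>j<N. ppartial (gs ! j + hs ! i) f * pvar (gs ! j)) = 0" if "i < N" for i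
    proof -
      have "hs ! i \<in> ?T" using that lh seth nth_mem by auto
      then have "(\<Sum>\<gamma>\<in>?S. ppartial (\<gamma> + hs ! i) f * pvar \<gamma>) = 0"
        unfolding assms(8) by (rule pade_det_relation[OF rs cs sq k finS])
      moreover have "(\<Sum>j<N. ppartial (gs ! j + hs ! i) f * pvar (gs ! j)) =
          (\<Sum>\<gamma>\<in>?S. ppartial (\<gamma> + hs ! i) f * pvar \<gamma>)"
        using setg lg by (intro sum.reindex_bij_betw bij_betw_nth) auto
      ultimately show ?thesis by simp
    qed
  qed
  show ?thesis using not_dense hessian_singular[OF assms(10)] by blast
qed

end
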